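(* For each integer $k\ge0$, let $\mathbb U_{2k}(q):=\sum_{n\ge0}u_{2k}(n)q^n$ with $u_{2k}(n):=\sum_{m\in\mathbb Z}m^{2k}u(m,n)$. Then as $t\to0^+$, $$\mathbb U_{2k}\!\left(e^{-t}\right)\sim\frac{(2k-1)!!}{4}\,t^{-k}e^{\frac{\pi^2}{6t}}.$$
   Context: A strongly unimodal sequence of size $n$ is a finite sequence of positive integers $\{a_j\}_{j=1}^s$ with $a_1<\dots<a_k>\dots>a_s$ for some $k$ and $\sum a_j=n$; its rank is $s-2k+1$; $u(m,n)$ is the number of such sequences of size $n$ and rank $m$. $(2k-1)!!=1\cdot3\cdots(2k-1)$ with $(-1)!!=1$; $0^0=1$. *)

theory Defs
  imports "HOL-Analysis.Analysis" "HOL-Library.Landau_Symbols"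
begin

text \<open>
  The peak position \<open>k\<close> is counted from 1, so the \<open>k\<close>-th entry is \<open>xs ! (k - 1)\<close>; it is the
  last entry of \<open>take k xs\<close> and the first entry of \<open>drop (k - 1) xs\<close>.
\<close>

definition is_peak :: "nat list \<Rightarrow> nat \<Rightarrow> bool" where
  "is_peak xs k \<longleftrightarrow> 1 \<le> k \<and> k \<le> length xs \<and>
     sorted_wrt (<) (take k xs) \<and> sorted_wrt (>) (drop (k - 1) xs)"

text \<open>A peak has to be an entry of the sequence, so the empty sequence is not strongly unimodal.\<close>

definition strongly_unimodal :: "nat list \<Rightarrow> bool" where
  "strongly_unimodal xs \<longleftrightarrow> (\<forall>x\<in>set xs. 0 < x) \<and> (\<exists>k. is_peak xs k)"

lemma is_peak_unique:
  assumes "is_peak xs k" "is_peak xs l"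
  shows "k = l"
proof -
  have no: False if p: "is_peak xs k" and q: "is_peak xs l" and less: "k < l" for k l
  proof -
    have "take l xs ! (k - 1) < take l xs ! k"
      using p q less unfolding is_peak_def
      by (intro sorted_wrt_nth_less[of "(<)"]) auto
    then have up: "xs ! (k - 1) < xs ! k"
      using p q less by (auto simp: is_peak_def)
    have "drop (k - 1) xs ! 0 > drop (k - 1) xs ! 1"
      using p q less unfolding is_peak_def
      by (intro sorted_wrt_nth_less[of "(>)"]) auto
    then have "xs ! (k - 1) > xs ! k"
      using p q less by (auto simp: is_peak_def)
    with up show False by simp
  qed
  show ?thesis using no assms by (meson linorder_neqE_nat)
qed

definition peak_pos :: "nat list \<Rightarrow> nat" where
  "peak_pos xs = (THE k. is_peak xs k)"

lemma peak_pos_eq: "is_peak xs k \<Longrightarrow> peak_pos xs = k"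
  unfolding peak_pos_def using is_peak_unique by blast

definition su_rank :: "nat list \<Rightarrow> int" where
  "su_rank xs = int (length xs) - 2 * int (peak_pos xs) + 1"

definition su_count :: "int \<Rightarrow> nat \<Rightarrow> nat" where
  "su_count m n = card {xs. strongly_unimodal xs \<and> sum_list xs = n \<and> su_rank xs = m}"

lemma finite_strongly_unimodal: "finite {xs. strongly_unimodal xs \<and> sum_list xs = n}"
proof (rule finite_subset)
  have len: "length xs \<le> sum_list xs" if "\<forall>x\<in>set xs. 0 < x" for xs :: "nat list"
    using that by (induction xs) auto
  show "{xs. strongly_unimodal xs \<and> sum_list xs = n} \<subseteq> {xs. set xs \<subseteq> {..n} \<and> length xs \<le> n}"
    using len member_le_sum_list by (fastforce simp: strongly_unimodal_def)
  show "finite {xs. set xs \<subseteq> {..n} \<and> length xs \<le> n}"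
    by (rule finite_lists_length_le) simp
qed

lemma finite_su_count_support: "finite {m. su_count m n \<noteq> 0}"
proof (rule finite_subset)
  show "{m. su_count m n \<noteq> 0} \<subseteq> su_rank ` {xs. strongly_unimodal xs \<and> sum_list xs = n}"
    by (auto simp: su_count_def card_eq_0_iff)
  show "finite (su_rank ` {xs. strongly_unimodal xs \<and> sum_list xs = n})"
    by (rule finite_imageI[OF finite_strongly_unimodal])
qed

text \<open>
  \<open>su_moment r n\<close> is the \<open>r\<close>-th rank moment of the strongly unimodal sequences of size \<open>n\<close>.
  By \<open>finite_su_count_support\<close> only finitely many terms of the sum over all integers are nonzero.
  As usual \<open>0 ^ 0 = 1\<close>, so that \<open>su_moment 0 n\<close> counts all of these sequences.
\<close>

definition su_moment :: "nat \<Rightarrow> nat \<Rightarrow> real" where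
  "su_moment r n = (\<Sum>\<^sub>\<infinity>m\<in>UNIV. of_int m ^ r * of_nat (su_count m n))"

definition su_moment_gf :: "nat \<Rightarrow> real \<Rightarrow> real" where
  "su_moment_gf r q = (\<Sum>n. su_moment r n * q ^ n)"

text \<open>\<open>odd_dfact k\<close> is \<open>(2 * k - 1)!!\<close>; the empty product gives \<open>(-1)!! = 1\<close>.\<close>

definition odd_dfact :: "nat \<Rightarrow> nat" where
  "odd_dfact k = (\<Prod>i=1..k. 2 * i - 1)"

end

theory Submission
  imports Defs "HOL-Real_Asymp.Real_Asymp"
begin

text \<open>
  Splitting a strongly unimodal sequence with peak \<open>N + 1\<close> into its left and right part gives the
  two-variable generating function \<open>U(x, q) = (\<Sum>N. q ^ (N + 1) * P N)\<close> with
  \<open>P N = (\<Prod>j=1..N. 1 + 2 * cosh x * q ^ j + q ^ (2 * j))\<close>, where \<open>exp x\<close> marks the rank.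
  Telescoping \<open>P N\<close> and \<open>q ^ N * P N\<close> shows that \<open>2 * cosh x * U(x, q)\<close> equals the infinite product
  \<open>P \<infinity>\<close> up to a relative error \<open>O(1 - q)\<close>. For \<open>q = exp (- t)\<close> the logarithm of \<open>P \<infinity>\<close> is a Riemann sum
  of a convex function, so the trapezoidal rule evaluates it up to an error \<open>O(t)\<close>; its integral is
  exactly \<open>pi\<^sup>2 / 6 + x\<^sup>2 / 2\<close>. Hence the ratio of \<open>U(s * sqrt t, exp (- t))\<close> to
  \<open>exp (pi\<^sup>2 / (6 * t)) / 4\<close> tends to the Gaussian \<open>exp (s\<^sup>2 / 2)\<close> for every \<open>s\<close>. The moments
  are the coefficients of \<open>U\<close> as a power series in \<open>x\<^sup>2\<close>; as they are nonnegative, pointwise convergence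
  of the series forces convergence of each coefficient.
\<close>

section \<open>The softplus function and its antiderivative\<close>

text \<open>The power series with these coefficients is -Li_2(-y). As division by zero gives 0, its
  constant coefficient vanishes.\<close>

definition dilog_coeff :: "nat \<Rightarrow> real" where
  "dilog_coeff n = - ((- 1) ^ n) / (real n)\<^sup>2"

lemma norm_dilog_coeff_le: "norm y \<le> 1 \<Longrightarrow> norm (dilog_coeff n * y ^ n) \<le> 1 / (real n)\<^sup>2"
  by (auto simp: dilog_coeff_def abs_mult power_abs divide_simps intro: power_le_one)

lemma summable_inverse_squares: "summable (\<lambda>n. 1 / (real n)\<^sup>2)"
  using inverse_power_summable[of 2, where 'a = real] by (simp add: field_simps)

lemma summable_dilog: "norm y \<le> 1 \<Longrightarrow> summable (\<lambda>n. dilog_coeff n * y ^ n)"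
  by (rule summable_comparison_test'[OF summable_inverse_squares norm_dilog_coeff_le])

text \<open>The endpoint y = 1 matters: under y = exp (- u) it corresponds to u = 0, where the
  antiderivative of \<open>softplus\<close> is evaluated.\<close>

lemma continuous_on_dilog: "continuous_on {-1..1} (\<lambda>y. \<Sum>n. dilog_coeff n * y ^ n)"
proof (rule uniform_limit_theorem)
  show "uniform_limit {-1..1} (\<lambda>n y. \<Sum>i<n. dilog_coeff i * y ^ i)
          (\<lambda>y. \<Sum>n. dilog_coeff n * y ^ n) sequentially"
    by (rule Weierstrass_m_test[OF norm_dilog_coeff_le summable_inverse_squares]) auto
qed (auto intro!: always_eventually continuous_intros)

text \<open>The alternating sum is the full sum of inverse squares minus twice its even part, and
  the even part is a quarter of the full sum.\<close>

lemma dilog_at_1: "(\<Sum>n. dilog_coeff n * 1 ^ n) = pi\<^sup>2 / 12"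
proof -
  have a: "(\<lambda>n. 1 / (real n)\<^sup>2) sums (pi\<^sup>2 / 6)"
    using inverse_squares_sums sums_Suc_iff[of "\<lambda>n. 1 / (real n)\<^sup>2" "pi\<^sup>2 / 6"] by (simp add: add_ac)
  have b: "(\<lambda>n. 1 / (real (2 * n))\<^sup>2) sums (pi\<^sup>2 / 24)"
    using sums_mult[OF a, of "1/4"] by (simp add: field_simps power2_eq_square)
  have "(\<lambda>n. if even n then 1 / (real n)\<^sup>2 else 0) sums (pi\<^sup>2 / 24)"
    using sums_if[OF sums_zero b]
    by (simp add: if_distrib cong: if_cong)
  from sums_diff[OF a sums_mult[OF this, of 2]]
  have "(\<lambda>n. dilog_coeff n * 1 ^ n) sums (pi\<^sup>2 / 6 - 2 * (pi\<^sup>2 / 24))"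
    by (rule sums_cong[THEN iffD1, rotated]) (auto simp: dilog_coeff_def)
  then show ?thesis
    by (simp add: sums_iff)
qed

text \<open>Termwise differentiation produces the logarithm series divided by y; composition with
  exp (- u) then yields \<open>softplus\<close> up to sign.\<close>

lemma dilog_has_derivative:
  fixes y :: real
  assumes "0 < y" "y < 1"
  shows "((\<lambda>y. \<Sum>n. dilog_coeff n * y ^ n) has_real_derivative ln (1 + y) / y) (at y)"
proof -
  have "(\<lambda>n. - ((- y) ^ n) / real n) sums ln (1 + y)"
    by (rule ln_series') (use assms in auto)
  then have "(\<lambda>n. - ((- y) ^ Suc n) / real (Suc n)) sums ln (1 + y)"
    by (subst sums_Suc_iff) simp
  from sums_divide[OF this, of y] have "(\<lambda>n. diffs dilog_coeff n * y ^ n) sums (ln (1 + y) / y)"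
    by (rule sums_cong[THEN iffD1, rotated])
       (use assms in \<open>auto simp: diffs_def dilog_coeff_def field_simps power2_eq_square power_minus[of y]
          simp del: of_nat_Suc\<close>)
  moreover have "((\<lambda>y. \<Sum>n. dilog_coeff n * y ^ n) has_real_derivative
      (\<Sum>n. diffs dilog_coeff n * y ^ n)) (at y)"
    by (rule termdiffs_strong[where K = 1]) (use assms summable_dilog[of 1] in auto)
  ultimately show ?thesis
    by (simp add: sums_iff)
qed

text \<open>The usual softplus with its argument negated, so that it decays at infinity.\<close>

definition softplus :: "real \<Rightarrow> real" where
  "softplus u = ln (1 + exp (- u))"

lemma softplus_pos: "softplus u > 0"
  by (simp add: softplus_def add_pos_pos)

lemma one_plus_exp_neq_0 [simp]: "1 + exp (u :: real) \<noteq> 0"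
  using exp_gt_zero[of u] by linarith

lemma softplus_has_derivative [derivative_intros]:
  assumes "(f has_real_derivative f') (at u within S)"
  shows "((\<lambda>u. softplus (f u)) has_real_derivative - f' / (1 + exp (f u))) (at u within S)"
  unfolding softplus_def
  by (rule derivative_eq_intros assms refl | simp add: add_pos_pos)+
     (simp add: field_simps exp_minus)

lemma softplus_minus: "softplus (- u) = softplus u + u"
proof -
  have "softplus (- u) = ln (exp u * (1 + exp (- u)))"
    by (simp add: softplus_def algebra_simps flip: exp_add)
  also have "\<dots> = u + softplus u"
    by (subst ln_mult) (auto simp: softplus_def add_pos_pos)
  finally show ?thesis by simp
qed

lemma softplus_tendsto_0: "(softplus \<longlongrightarrow> 0) at_top"
  unfolding softplus_def by real_asymp

text \<open>The explicit candidate \<open>D\<close>, which is Li_2(- exp (- u)), is given by a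
  series that converges only for u \<ge> 0. So a global antiderivative \<open>F\<close> is taken
  from the continuity of \<open>softplus\<close> and identified with \<open>D\<close> for u > 0,
  which gives its limit.\<close>

lemma ex_softplus_antiderivative:
  "\<exists>F. (\<forall>u. (F has_real_derivative softplus u) (at u)) \<and> (F \<longlongrightarrow> 0) at_top \<and> F 0 = - (pi\<^sup>2 / 12)"
proof -
  define D where "D u = - (\<Sum>n. dilog_coeff n * exp (- u) ^ n)" for u :: real
  have "isCont softplus u" for u
    by (rule DERIV_isCont[OF softplus_has_derivative[OF DERIV_ident]])
  then obtain F0 where F0: "(F0 has_real_derivative softplus u) (at u)" for u
    using einterval_antiderivative[of "-\<infinity>" "\<infinity>" softplus]
    by (auto simp: has_real_derivative_iff_has_vector_derivative)
  \<comment> \<open>The constant is the value of \<open>D\<close> at 0, so that the two functions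
    coincide on the positive half-line.\<close>
  define F where "F u = F0 u - F0 0 - pi\<^sup>2 / 12" for u
  have F: "(F has_real_derivative softplus u) (at u)" for u
    unfolding F_def by (rule derivative_eq_intros F0 refl | simp)+
  have D': "(D has_real_derivative softplus u) (at u)" if "u > 0" for u
  proof -
    have "((\<lambda>u. (\<lambda>y. \<Sum>n. dilog_coeff n * y ^ n) (exp (- u))) has_real_derivative
        ln (1 + exp (- u)) / exp (- u) * (exp (- u) * - 1)) (at u)"
      by (rule DERIV_chain2[OF dilog_has_derivative]) (use that in \<open>auto intro!: derivative_eq_intros\<close>)
    from DERIV_minus[OF this] show ?thesis
      by (simp add: D_def [abs_def] softplus_def)
  qed
  have "- 1 \<le> exp (- u)" for u :: real
    by (rule order_trans[of _ 0]) auto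
  then have D_cont: "continuous_on {0..} D"
    unfolding D_def
    by (intro continuous_on_minus continuous_on_compose2[OF continuous_on_dilog] continuous_intros) auto
  have eq: "F u = D u" if "u > 0" for u
  proof -
    have "F u - D u = F 0 - D 0"
    proof (rule DERIV_isconst_end[OF that])
      have "continuous_on {0..u} F"
        using F by (meson DERIV_continuous continuous_at_imp_continuous_on)
      then show "continuous_on {0..u} (\<lambda>u. F u - D u)"
        by (intro continuous_intros) (auto intro: continuous_on_subset[OF D_cont])
      show "((\<lambda>u. F u - D u) has_real_derivative 0) (at x)" if "0 < x" for x
        using DERIV_diff[OF F D'[OF that]] by simp
    qed
    also have "D 0 = - (pi\<^sup>2 / 12)"
      using dilog_at_1 by (simp add: D_def)
    finally show ?thesis by (simp add: F_def)
  qed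
  have "isCont (\<lambda>y. \<Sum>n. dilog_coeff n * y ^ n) 0"
    using continuous_on_interior[OF continuous_on_dilog, of 0] by (simp add: interior_atLeastAtMost_real)
  then have "((\<lambda>u. \<Sum>n. dilog_coeff n * exp (- u) ^ n) \<longlongrightarrow> (\<Sum>n. dilog_coeff n * 0 ^ n)) at_top"
    by (rule isCont_tendsto_compose) real_asymp
  moreover have "(\<Sum>n. dilog_coeff n * 0 ^ n) = 0"
    by (subst powser_zero) (simp add: dilog_coeff_def)
  ultimately have "((\<lambda>u. \<Sum>n. dilog_coeff n * exp (- u) ^ n) \<longlongrightarrow> 0) at_top"
    by simp
  then have "(D \<longlongrightarrow> 0) at_top"
    unfolding D_def by (rule tendsto_eq_intros) simp
  then have "(F \<longlongrightarrow> 0) at_top"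
    by (rule Lim_transform_eventually)
       (use eventually_gt_at_top[of 0] in eventually_elim, use eq in auto)
  with F show ?thesis
    by (intro exI[of _ F]) (simp add: F_def)
qed

text \<open>This is minus the integral of \<open>softplus\<close> from u to infinity.\<close>

definition softplus_int :: "real \<Rightarrow> real" where
  "softplus_int = (SOME F. (\<forall>u. (F has_real_derivative softplus u) (at u)) \<and>
     (F \<longlongrightarrow> 0) at_top \<and> F 0 = - (pi\<^sup>2 / 12))"

lemma
  shows softplus_int_has_derivative: "(softplus_int has_real_derivative softplus u) (at u)"
    and softplus_int_tendsto_0: "(softplus_int \<longlongrightarrow> 0) at_top"
    and softplus_int_0: "softplus_int 0 = - (pi\<^sup>2 / 12)"
  using someI_ex[OF ex_softplus_antiderivative] unfolding softplus_int_def by blast+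

text \<open>The inversion formula of the dilogarithm: by \<open>softplus_minus\<close> both sides
  have the same derivative. The quadratic term is the source of the Gaussian.\<close>

lemma softplus_int_reflect: "softplus_int x + softplus_int (- x) = - (pi\<^sup>2 / 6) - x\<^sup>2 / 2"
proof -
  define h where "h x = softplus_int x + softplus_int (- x) + x\<^sup>2 / 2" for x
  have "(h has_real_derivative 0) (at y)" for y
    unfolding h_def
    by (rule derivative_eq_intros DERIV_chain2[OF softplus_int_has_derivative]
          softplus_int_has_derivative refl | simp add: softplus_minus)+
  then have "h x = h 0"
    by (intro DERIV_isconst_all) auto
  then show ?thesis
    by (simp add: h_def softplus_int_0)
qed

section \<open>The trapezoidal rule for convex functions\<close>

text \<open>Two mean value steps turn the error into t * h / 2 times a difference of values of
  \<open>f'\<close> at points between a and a + t; monotonicity of \<open>f'\<close> bounds it on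
  both sides.\<close>

lemma trapezoid_step:
  fixes f f' g :: "real \<Rightarrow> real"
  assumes g: "\<And>u. (g has_real_derivative f u) (at u)"
    and f: "\<And>u. (f has_real_derivative f' u) (at u)"
    and mono: "\<And>u v. u \<le> v \<Longrightarrow> f' u \<le> f' v"
    and "t > 0"
  shows "t * ((f a + f (a + t)) / 2) - (g (a + t) - g a) \<in> {0..t\<^sup>2 / 2 * (f' (a + t) - f' a)}"
proof -
  define E where "E h = h * ((f a + f (a + h)) / 2) - (g (a + h) - g a)" for h
  define E' where "E' h = (h * f' (a + h) - (f (a + h) - f a)) / 2" for h
  have E: "(E has_real_derivative E' h) (at h)" for h
    unfolding E_def E'_def
    by (rule derivative_eq_intros DERIV_chain2[OF f] DERIV_chain2[OF g] refl | simp add: field_simps)+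
  obtain h where h: "0 < h" "h < t" "E t - E 0 = (t - 0) * E' h"
    using MVT2[of 0 t E E'] E \<open>t > 0\<close> by blast
  obtain \<xi> where \<xi>: "a < \<xi>" "\<xi> < a + h" "f (a + h) - f a = (a + h - a) * f' \<xi>"
    using MVT2[of a "a + h" f f'] f h by auto
  have *: "E t = t * h / 2 * (f' (a + h) - f' \<xi>)"
    using h(3) \<xi>(3) by (simp add: E_def E'_def field_simps)
  have "E t \<ge> 0"
    unfolding * using mono[of \<xi> "a + h"] \<xi> h \<open>t > 0\<close> by auto
  moreover have "E t \<le> t * t / 2 * (f' (a + t) - f' a)"
    unfolding * using mono[of \<xi> "a + h"] mono[of a \<xi>] mono[of "a + h" "a + t"] \<xi> h \<open>t > 0\<close>
    by (intro mult_mono) auto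
  ultimately show ?thesis
    by (simp add: E_def power2_eq_square)
qed

text \<open>The increments of \<open>f'\<close> telescope, so the error bound sees only the
  endpoints.\<close>

lemma trapezoid_sum:
  fixes f f' g :: "real \<Rightarrow> real"
  assumes g: "\<And>u. (g has_real_derivative f u) (at u)"
    and f: "\<And>u. (f has_real_derivative f' u) (at u)"
    and mono: "\<And>u v. u \<le> v \<Longrightarrow> f' u \<le> f' v"
    and "t > 0"
  shows "t * ((\<Sum>j=1..n. f (real j * t)) + f 0 / 2 - f (real n * t) / 2) - (g (real n * t) - g 0)
           \<in> {0..t\<^sup>2 / 2 * (f' (real n * t) - f' 0)}"
proof (induction n)
  case (Suc n)
  have "real n * t + t = real (Suc n) * t"
    by (simp add: algebra_simps)
  with Suc.IH trapezoid_step[OF g f mono \<open>t > 0\<close>, of "real n * t"] show ?case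
    by (simp add: algebra_simps add_divide_distrib)
qed auto

section \<open>Asymptotics of the two-variable generating function\<close>

text \<open>At u = j * t this is the logarithm of the j-th factor of the product for q = exp (- t),
  see \<open>su_prod_eq_exp\<close>.\<close>

definition softplus_pair :: "real \<Rightarrow> real \<Rightarrow> real" where
  "softplus_pair x u = softplus (u + x) + softplus (u - x)"

lemma softplus_le_exp: "softplus u \<le> exp (- u)"
  unfolding softplus_def by (rule ln_add_one_self_le_self) simp

lemma softplus_pair_le: "softplus_pair x u \<le> 2 * cosh x * exp (- u)"
proof -
  have "exp (- (u + x)) + exp (- (u - x)) = 2 * cosh x * exp (- u)"
    by (simp add: cosh_field_def exp_add exp_diff exp_minus field_simps)
  with softplus_le_exp[of "u + x"] softplus_le_exp[of "u - x"] show ?thesis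
    by (simp add: softplus_pair_def)
qed

lemma softplus_pair_0: "softplus_pair x 0 = ln (2 + 2 * cosh x)"
proof -
  have "softplus_pair x 0 = ln ((1 + exp (- x)) * (1 + exp x))"
    by (subst ln_mult) (auto simp: softplus_pair_def softplus_def add_pos_pos)
  also have "(1 + exp (- x)) * (1 + exp x) = 2 + 2 * cosh x"
    by (simp add: cosh_field_def algebra_simps flip: exp_add)
  finally show ?thesis .
qed

text \<open>Let n tend to infinity in \<open>trapezoid_sum\<close>:
  \<open>softplus_int_reflect\<close> evaluates the integral, the half weight of the node 0 gives
  the logarithmic term, and division by t turns the error t^2 / 2 into t / 2.\<close>

lemma softplus_pair_sum_bounds:
  fixes t x :: real
  assumes "t > 0"
  defines "A \<equiv> (pi\<^sup>2 / 6 + x\<^sup>2 / 2) / t - ln (2 + 2 * cosh x) / 2"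
  shows "\<exists>\<sigma>\<in>{A..A + t / 2}. (\<lambda>n. \<Sum>j=1..n. softplus_pair x (real j * t)) \<longlonglongrightarrow> \<sigma>"
proof -
  define g where "g u = softplus_int (u + x) + softplus_int (u - x)" for u
  define f' where "f' u = - 1 / (1 + exp (u + x)) + - 1 / (1 + exp (u - x))" for u
  let ?f = "softplus_pair x"
  have g: "(g has_real_derivative ?f u) (at u)" for u
    unfolding g_def softplus_pair_def
    by (rule derivative_eq_intros DERIV_chain2[OF softplus_int_has_derivative] refl | simp)+
  have f: "(?f has_real_derivative f' u) (at u)" for u
    unfolding f'_def softplus_pair_def
    by (rule derivative_eq_intros refl | simp)+
  have mono: "f' u \<le> f' v" if "u \<le> v" for u v
    unfolding f'_def using that by (intro add_mono divide_left_mono_neg) (auto simp: add_pos_pos)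
  have pos: "?f u > 0" for u
    by (simp add: softplus_pair_def softplus_pos add_pos_pos)
  have shift: "filterlim (\<lambda>n. real n * t + c) at_top sequentially" for c
    using assms by real_asymp
  have f_lim: "(\<lambda>n. ?f (real n * t)) \<longlonglongrightarrow> 0"
    unfolding softplus_pair_def
    using tendsto_add[OF filterlim_compose[OF softplus_tendsto_0 shift[of x]]
        filterlim_compose[OF softplus_tendsto_0 shift[of "- x"]]] by simp
  have g_lim: "(\<lambda>n. g (real n * t)) \<longlonglongrightarrow> 0"
    unfolding g_def
    using tendsto_add[OF filterlim_compose[OF softplus_int_tendsto_0 shift[of x]]
        filterlim_compose[OF softplus_int_tendsto_0 shift[of "- x"]]] by simp
  have "summable (\<lambda>n. ?f (real (Suc n) * t))"
  proof (rule summable_comparison_test')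
    show "summable (\<lambda>n. 2 * cosh x * exp (- t) * exp (- t) ^ n)"
      using assms by (intro summable_mult summable_geometric) auto
    have "exp (- (real (Suc n) * t)) = exp (- t) * exp (- t) ^ n" for n
      by (simp add: algebra_simps flip: exp_of_nat_mult exp_add)
    then show "norm (?f (real (Suc n) * t)) \<le> 2 * cosh x * exp (- t) * exp (- t) ^ n" for n
      using softplus_pair_le[of x "real (Suc n) * t"] pos[of "real (Suc n) * t"]
      by (simp del: of_nat_Suc)
  qed
  then obtain \<sigma> where "(\<lambda>n. ?f (real (Suc n) * t)) sums \<sigma>"
    by blast
  then have \<sigma>: "(\<lambda>n. \<Sum>j=1..n. ?f (real j * t)) \<longlonglongrightarrow> \<sigma>"
    by (simp add: sums_def sum.atLeast1_atMost_eq)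
  define T where "T n = t * ((\<Sum>j=1..n. ?f (real j * t)) + ?f 0 / 2 - ?f (real n * t) / 2)
      - (g (real n * t) - g 0)" for n
  have T_lim: "T \<longlonglongrightarrow> t * (\<sigma> + ?f 0 / 2 - 0 / 2) - (0 - g 0)"
    unfolding T_def by (intro tendsto_intros \<sigma> f_lim g_lim) auto
  have T_bounds: "T n \<in> {0..t\<^sup>2 / 2}" for n
  proof -
    \<comment> \<open>As 1 / (1 + exp x) + 1 / (1 + exp (- x)) = 1, this slope does not depend on x.
      The error is thus uniform in x, which matters because x will vary with t.\<close>
    have "f' 0 = - 1"
      using one_plus_exp_neq_0[of x] by (simp add: f'_def exp_minus field_simps)
    moreover have "f' u \<le> 0" for u
      unfolding f'_def by (intro add_nonpos_nonpos divide_nonpos_pos) (auto simp: add_pos_pos)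
    ultimately have "t\<^sup>2 / 2 * (f' (real n * t) - f' 0) \<le> t\<^sup>2 / 2 * 1"
      by (intro mult_left_mono) auto
    with trapezoid_sum[OF g f mono assms(1), of n] show ?thesis
      by (auto simp: T_def)
  qed
  have "t * (\<sigma> + ?f 0 / 2 - 0 / 2) - (0 - g 0) \<in> {0..t\<^sup>2 / 2}"
    by (rule closed_sequentially[OF closed_atLeastAtMost T_bounds T_lim])
  then have "t * (\<sigma> + ?f 0 / 2) + g 0 \<in> {0..t\<^sup>2 / 2}"
    by simp
  moreover have "g 0 = - (pi\<^sup>2 / 6 + x\<^sup>2 / 2)"
    using softplus_int_reflect[of x] by (simp add: g_def)
  ultimately have "\<sigma> \<in> {A..A + t / 2}"
    using \<open>t > 0\<close> by (simp add: A_def softplus_pair_0 field_simps power2_eq_square)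
  with \<sigma> show ?thesis
    by blast
qed

section \<open>Partial products and telescoping bounds\<close>

definition su_prod :: "real \<Rightarrow> real \<Rightarrow> nat \<Rightarrow> real" where
  "su_prod x q N = (\<Prod>j=1..N. (1 + exp x * q ^ j) * (1 + exp (- x) * q ^ j))"

lemma su_prod_0 [simp]: "su_prod x q 0 = 1"
  by (simp add: su_prod_def)

lemma su_prod_Suc:
  "su_prod x q (Suc N) = su_prod x q N * (1 + 2 * cosh x * q ^ Suc N + (q ^ Suc N)\<^sup>2)"
proof -
  have "(1 + exp x * y) * (1 + exp (- x) * y) = 1 + 2 * cosh x * y + y\<^sup>2" for y
    by (simp add: cosh_field_def algebra_simps power2_eq_square flip: exp_add)
  then show ?thesis
    by (simp add: su_prod_def)
qed

lemma su_prod_pos: "q > 0 \<Longrightarrow> su_prod x q N > 0"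
  unfolding su_prod_def by (intro prod_pos mult_pos_pos add_pos_pos) auto

lemma su_prod_mono: "q > 0 \<Longrightarrow> incseq (su_prod x q)"
  by (intro incseq_SucI)
     (auto simp: su_prod_Suc algebra_simps intro!: add_nonneg_nonneg mult_nonneg_nonneg less_imp_le[OF su_prod_pos])

lemma su_prod_eq_exp: "su_prod x (exp (- t)) N = exp (\<Sum>j=1..N. softplus_pair x (real j * t))"
proof -
  have "(1 + exp x * exp (- t) ^ j) * (1 + exp (- x) * exp (- t) ^ j)
          = exp (softplus_pair x (real j * t))" for j
    by (simp add: softplus_pair_def softplus_def exp_add add_pos_pos algebra_simps
        flip: exp_of_nat_mult) (simp add: exp_add exp_diff exp_minus field_simps)
  then show ?thesis
    by (simp add: su_prod_def exp_sum)
qed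

lemma su_prod_limit:
  fixes t x :: real
  assumes "t > 0"
  defines "A \<equiv> (pi\<^sup>2 / 6 + x\<^sup>2 / 2) / t - ln (2 + 2 * cosh x) / 2"
  shows "\<exists>L\<in>{exp A..exp (A + t / 2)}. su_prod x (exp (- t)) \<longlonglongrightarrow> L"
proof -
  obtain \<sigma> where \<sigma>: "\<sigma> \<in> {A..A + t / 2}"
      "(\<lambda>n. \<Sum>j=1..n. softplus_pair x (real j * t)) \<longlonglongrightarrow> \<sigma>"
    using softplus_pair_sum_bounds[OF assms(1), of x] unfolding A_def by blast
  have "su_prod x (exp (- t)) \<longlonglongrightarrow> exp \<sigma>"
    unfolding su_prod_eq_exp using \<sigma>(2) by (rule tendsto_exp)
  with \<sigma>(1) show ?thesis
    by (intro bexI[of _ "exp \<sigma>"]) auto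
qed

text \<open>The peak has size N + 1; that this series counts sequences by rank is shown in
  \<open>has_sum_exp_su_rank\<close>.\<close>

definition su_rank_gf :: "real \<Rightarrow> real \<Rightarrow> real" where
  "su_rank_gf x q = (\<Sum>N. q ^ Suc N * su_prod x q N)"

text \<open>Let U and V be the sums of \<open>u\<close> and \<open>v\<close>. Telescoping the
  products gives L - 1 = c * U + V, and telescoping \<open>a\<close> gives c * V \<le> (1 / q - 1) *
  U. Then V \<ge> 0 yields the upper bound, and the estimate of V the lower one.\<close>

lemma su_rank_gf_bounds:
  assumes q: "0 < q" "q < 1" and L: "su_prod x q \<longlonglongrightarrow> L"
  defines "c \<equiv> 2 * cosh x"
  shows "summable (\<lambda>N. q ^ Suc N * su_prod x q N)"
    and "su_rank_gf x q \<in> {(L - 1) / (c + (1 / q - 1) / c)..(L - 1) / c}"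
proof -
  let ?P = "su_prod x q"
  define u v where "u N = q ^ Suc N * ?P N" and "v N = (q ^ Suc N)\<^sup>2 * ?P N" for N
  have P_le: "?P N \<le> L" for N
    using incseq_le[OF su_prod_mono[OF q(1)] L] .
  have P_pos: "?P N > 0" for N
    using su_prod_pos[OF q(1)] .
  have c: "c > 0"
    by (simp add: c_def)
  have geo: "summable (\<lambda>N. L * q * q ^ N)"
    using q by (intro summable_mult summable_geometric) auto
  have le: "norm (u N) \<le> L * q * q ^ N" for N
    using P_le[of N] P_pos[of N] q by (simp add: u_def abs_mult)
  have u: "summable u"
    using summable_comparison_test'[OF geo le] .
  have "norm (v N) \<le> L * q * q ^ N" for N
  proof -
    have "v N = q ^ Suc N * u N"
      by (simp add: u_def v_def power2_eq_square)
    moreover have "q ^ Suc N \<le> 1"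
      using q by (intro power_le_one) auto
    ultimately have "norm (v N) \<le> norm (u N)"
      using q by (simp add: abs_mult mult_left_le_one_le del: power_Suc)
    with le show ?thesis by (rule order_trans[rotated])
  qed
  then have v: "summable v"
    using summable_comparison_test'[OF geo] by blast
  show "summable (\<lambda>N. q ^ Suc N * su_prod x q N)"
    using u unfolding u_def .
  have "(\<lambda>N. ?P (Suc N) - ?P N) sums (L - ?P 0)"
    using L by (rule telescope_sums)
  moreover have "?P (Suc N) - ?P N = c * u N + v N" for N
    by (simp add: su_prod_Suc u_def v_def c_def algebra_simps)
  ultimately have 1: "L - 1 = c * suminf u + suminf v"
    using sums_add[OF sums_mult[OF summable_sums[OF u], of c] summable_sums[OF v]]
    by (auto intro: sums_unique2)
  \<comment> \<open>The weight q ^ N moves the coefficient c from \<open>u\<close> to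
    \<open>v\<close> and forces the limit 0, so the differences have the nonpositive total -
    1.\<close>
  define a where "a N = q ^ N * ?P N" for N
  have "(\<lambda>N. q ^ N) \<longlonglongrightarrow> 0"
    using q by (intro LIMSEQ_realpow_zero) auto
  from tendsto_mult[OF this L] have "a \<longlonglongrightarrow> 0"
    by (simp add: a_def [abs_def])
  then have tele: "(\<lambda>N. a (Suc N) - a N) sums (0 - a 0)"
    by (rule telescope_sums)
  have step: "- (1 / q - 1) * u N + c * v N \<le> a (Suc N) - a N" for N
  proof -
    have "a (Suc N) - a N = - (1 / q - 1) * u N + c * v N + q ^ Suc N * v N"
      using q by (simp add: su_prod_Suc u_def v_def c_def a_def field_simps power2_eq_square)
    moreover have "q ^ Suc N * v N \<ge> 0"
      using q P_pos[of N] by (simp add: v_def)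
    ultimately show ?thesis by linarith
  qed
  have "- (1 / q - 1) * suminf u + c * suminf v \<le> 0 - a 0"
    by (rule sums_le[OF step _ tele]) (intro sums_add sums_mult summable_sums u v)
  then have "c * suminf v \<le> (1 / q - 1) * suminf u"
    by (simp add: a_def algebra_simps)
  then have 2: "suminf v \<le> (1 / q - 1) / c * suminf u"
    using c by (simp add: field_simps)
  have 3: "suminf v \<ge> 0"
    using q P_pos by (intro suminf_nonneg[OF v]) (auto simp: v_def less_imp_le)
  have eq: "su_rank_gf x q = suminf u"
    unfolding su_rank_gf_def u_def ..
  have "1 / q - 1 > 0"
    using q by simp
  then have d: "c + (1 / q - 1) / c > 0"
    using c by (intro add_pos_pos divide_pos_pos)
  have "L - 1 \<le> (c + (1 / q - 1) / c) * suminf u"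
    using 1 2 by (simp only: distrib_right)
  then have "(L - 1) / (c + (1 / q - 1) / c) \<le> suminf u"
    using d by (simp only: pos_divide_le_eq mult.commute)
  moreover have "suminf u \<le> (L - 1) / c"
    using 1 3 c by (simp add: field_simps)
  ultimately show "su_rank_gf x q \<in> {(L - 1) / (c + (1 / q - 1) / c)..(L - 1) / c}"
    by (simp add: eq)
qed

text \<open>For x = s * sqrt t the term x^2 / (2 * t) is the constant s^2 / 2. The factor 1 / 4 is
  the limit of exp (- ln (2 + 2 * cosh x) / 2) / (2 * cosh x) as x tends to 0.\<close>

lemma su_rank_gf_asymp:
  "((\<lambda>t. su_rank_gf (s * sqrt t) (exp (- t)) / (exp (pi\<^sup>2 / (6 * t)) / 4)) \<longlongrightarrow> exp (s\<^sup>2 / 2)) (at_right 0)"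
proof -
  define c where "c t = 2 * cosh (s * sqrt t)" for t
  \<comment> \<open>\<open>l\<close> and \<open>r\<close> are the bounds of
    \<open>su_rank_gf_bounds\<close> with L replaced by exp A and exp (A + t / 2), divided by the
    target. The subtracted exponential in \<open>l\<close> stems from the - 1 in L - 1, which is
    dropped in \<open>r\<close>.\<close>
  define l where "l t = (4 * exp (s\<^sup>2 / 2) * exp (- (ln (2 + c t) / 2)) - 4 * exp (- (pi\<^sup>2 / (6 * t))))
      / (c t + (exp t - 1) / c t)" for t
  define r where "r t = (4 * exp (s\<^sup>2 / 2) * exp (- (ln (2 + c t) / 2)) * exp (t / 2)) / c t" for t
  have sq: "(sqrt \<longlongrightarrow> 0) (at_right 0)"
    by real_asymp
  have "((\<lambda>t. 2 * cosh (s * sqrt t)) \<longlongrightarrow> 2 * cosh (s * 0)) (at_right 0)"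
    by (intro tendsto_intros sq)
  then have c: "(c \<longlongrightarrow> 2) (at_right 0)"
    by (simp add: c_def [abs_def])
  have e0: "((\<lambda>t. exp (- (pi\<^sup>2 / (6 * t)))) \<longlongrightarrow> 0) (at_right 0)"
    by real_asymp
  have e1: "((\<lambda>t::real. exp t - 1) \<longlongrightarrow> 0) (at_right 0)"
    by real_asymp
  have e2: "((\<lambda>t::real. exp (t / 2)) \<longlongrightarrow> 1) (at_right 0)"
    by real_asymp
  have ln4: "exp (- (ln (2 + 2) / 2)) = 1 / (2::real)"
  proof -
    have "ln (2 + 2 :: real) / 2 = ln 2"
      using ln_realpow[of 2 2] by simp
    then show ?thesis
      by (simp add: exp_minus)
  qed
  have "(l \<longlongrightarrow> (4 * exp (s\<^sup>2 / 2) * exp (- (ln (2 + 2) / 2)) - 4 * 0) / (2 + 0 / 2)) (at_right 0)"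
    unfolding l_def by (intro tendsto_intros c e0 e1) auto
  then have l: "(l \<longlongrightarrow> exp (s\<^sup>2 / 2)) (at_right 0)"
    unfolding ln4 by simp
  have "(r \<longlongrightarrow> (4 * exp (s\<^sup>2 / 2) * exp (- (ln (2 + 2) / 2)) * 1) / 2) (at_right 0)"
    unfolding r_def by (intro tendsto_intros c e2) auto
  then have r: "(r \<longlongrightarrow> exp (s\<^sup>2 / 2)) (at_right 0)"
    unfolding ln4 by simp
  have bounds: "su_rank_gf (s * sqrt t) (exp (- t)) / (exp (pi\<^sup>2 / (6 * t)) / 4) \<in> {l t..r t}"
    if t: "t > 0" for t
  proof -
    define x where "x = s * sqrt t"
    define A where "A = (pi\<^sup>2 / 6 + x\<^sup>2 / 2) / t - ln (2 + 2 * cosh x) / 2"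
    obtain L where L: "L \<in> {exp A..exp (A + t / 2)}" "su_prod x (exp (- t)) \<longlonglongrightarrow> L"
      using su_prod_limit[OF t, of x] unfolding A_def by blast
    have exp_t: "1 / exp (- t) = exp t"
      by (simp add: exp_minus field_simps)
    have U: "su_rank_gf x (exp (- t)) \<in> {(L - 1) / (c t + (exp t - 1) / c t)..(L - 1) / c t}"
      using su_rank_gf_bounds(2)[OF _ _ L(2)] t unfolding c_def x_def exp_t by simp
    have ct: "c t > 0"
      by (simp add: c_def)
    have d: "c t + (exp t - 1) / c t > 0"
      using t ct by (intro add_pos_nonneg divide_nonneg_pos) auto
    define E where "E = exp (pi\<^sup>2 / (6 * t))"
    have A: "exp A = E * exp (s\<^sup>2 / 2) * exp (- (ln (2 + c t) / 2))"
    proof -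
      have "(pi\<^sup>2 / 6 + x\<^sup>2 / 2) / t = pi\<^sup>2 / (6 * t) + s\<^sup>2 / 2"
        using t by (simp add: x_def power_mult_distrib field_simps)
      then have "A = pi\<^sup>2 / (6 * t) + s\<^sup>2 / 2 + - (ln (2 + c t) / 2)"
        by (simp add: A_def x_def c_def)
      then show ?thesis
        by (simp only: exp_add E_def)
    qed
    have E: "E > 0" "exp (- (pi\<^sup>2 / (6 * t))) = 1 / E"
      by (auto simp: E_def exp_minus field_simps)
    have "l t = (exp A - 1) / (c t + (exp t - 1) / c t) / (E / 4)"
      unfolding l_def A E using E(1) d by (simp add: field_simps)
    also have "\<dots> \<le> (L - 1) / (c t + (exp t - 1) / c t) / (E / 4)"
      using L(1) d E(1) by (intro divide_right_mono) auto
    also have "\<dots> \<le> su_rank_gf x (exp (- t)) / (E / 4)"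
      using U E(1) by (intro divide_right_mono) auto
    finally have 1: "l t \<le> su_rank_gf x (exp (- t)) / (E / 4)" .
    have "su_rank_gf x (exp (- t)) / (E / 4) \<le> (L - 1) / c t / (E / 4)"
      using U E(1) by (intro divide_right_mono) auto
    also have "\<dots> \<le> exp (A + t / 2) / c t / (E / 4)"
      using L(1) ct E(1) by (intro divide_right_mono) auto
    also have "\<dots> = r t"
      unfolding r_def exp_add A using E(1) ct by (simp add: field_simps)
    finally show ?thesis
      using 1 by (simp add: x_def E_def)
  qed
  have ev: "eventually (\<lambda>t. t > (0::real)) (at_right 0)"
    by (simp add: eventually_at_right_less)
  show ?thesis
    by (rule tendsto_sandwich[OF _ _ l r]; use ev in eventually_elim; use bounds in auto)
qed

section \<open>Generating functions of strongly unimodal sequences\<close>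

lemma is_peak_append_iff:
  "is_peak (ys @ p # zs) (Suc (length ys)) \<longleftrightarrow> sorted_wrt (<) (ys @ [p]) \<and> sorted_wrt (>) (p # zs)"
  by (simp add: is_peak_def)

lemma strongly_unimodalE:
  assumes "strongly_unimodal xs"
  obtains ys p zs where "xs = ys @ p # zs" "sorted_wrt (<) (ys @ [p])" "sorted_wrt (>) (p # zs)"
    "\<forall>x\<in>set xs. 0 < x"
proof -
  obtain k where k: "is_peak xs k" and pos: "\<forall>x\<in>set xs. 0 < x"
    using assms by (auto simp: strongly_unimodal_def)
  define ys p zs where "ys = take (k - 1) xs" and "p = xs ! (k - 1)" and "zs = drop k xs"
  have "k = Suc (k - 1)" "k - 1 < length xs"
    using k by (auto simp: is_peak_def)
  then have xs: "xs = ys @ p # zs" and len: "Suc (length ys) = k"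
    using id_take_nth_drop[of "k - 1" xs] by (auto simp: ys_def p_def zs_def)
  with k have "sorted_wrt (<) (ys @ [p])" "sorted_wrt (>) (p # zs)"
    using is_peak_append_iff[of ys p zs] by auto
  with xs pos show thesis
    by (intro that)
qed

text \<open>A strictly monotone list is determined by its set, so A and B hold the entries before
  and after the peak \<open>Suc N\<close>. With the peak written as a successor, the smaller
  positive entries are exactly \<open>{1..N}\<close>.\<close>

definition su_of :: "nat \<times> nat set \<times> nat set \<Rightarrow> nat list" where
  "su_of = (\<lambda>(N, A, B). sorted_list_of_set A @ Suc N # rev (sorted_list_of_set B))"

definition su_index :: "(nat \<times> nat set \<times> nat set) set" where
  "su_index = (SIGMA N:UNIV. Pow {1..N} \<times> Pow {1..N})"

context
  fixes N :: nat and A B :: "nat set"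
  assumes AB: "A \<subseteq> {1..N}" "B \<subseteq> {1..N}"
begin

lemma finite_su_of: "finite A" "finite B"
  using AB by (auto intro: finite_subset)

lemma is_peak_su_of: "is_peak (su_of (N, A, B)) (Suc (card A))"
proof -
  have "sorted_wrt (<) (sorted_list_of_set A @ [Suc N])"
    using AB finite_su_of by (force simp: sorted_wrt_append)
  moreover have "sorted_wrt (>) (Suc N # rev (sorted_list_of_set B))"
    using AB finite_su_of by (force simp: sorted_wrt_rev)
  ultimately show ?thesis
    using is_peak_append_iff[of "sorted_list_of_set A" "Suc N" "rev (sorted_list_of_set B)"]
    by (simp add: su_of_def)
qed

lemma strongly_unimodal_su_of: "strongly_unimodal (su_of (N, A, B))"
  unfolding strongly_unimodal_def
proof
  show "\<forall>x\<in>set (su_of (N, A, B)). 0 < x"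
    using AB finite_su_of by (force simp: su_of_def)
qed (use is_peak_su_of in blast)

lemma peak_pos_su_of: "peak_pos (su_of (N, A, B)) = Suc (card A)"
  by (rule peak_pos_eq[OF is_peak_su_of])

lemma su_rank_su_of: "su_rank (su_of (N, A, B)) = int (card B) - int (card A)"
  by (simp add: su_rank_def peak_pos_su_of) (simp add: su_of_def)

lemma sum_list_su_of: "sum_list (su_of (N, A, B)) = Suc N + (\<Sum>A + \<Sum>B)"
proof -
  have "sum_list (sorted_list_of_set X) = \<Sum>X" if "finite X" for X :: "nat set"
    using that sum_list_distinct_conv_sum_set[of "sorted_list_of_set X" "\<lambda>x. x"] by simp
  then show ?thesis
    using finite_su_of by (simp add: su_of_def)
qed

end

text \<open>Injectivity rests on the uniqueness of the peak position; for surjectivity, cut at the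
  peak and recover each strictly sorted side from its set.\<close>

lemma bij_betw_su_of: "bij_betw su_of su_index {xs. strongly_unimodal xs}"
  unfolding bij_betw_def
proof
  show "inj_on su_of su_index"
  proof (rule inj_onI)
    fix z z'
    assume in_index: "z \<in> su_index" "z' \<in> su_index" and su_eq: "su_of z = su_of z'"
    obtain N A B N' A' B' where z: "z = (N, A, B)" "z' = (N', A', B')"
      by (metis prod_cases3)
    note eq = su_eq[unfolded z]
    from in_index z have sub: "A \<subseteq> {1..N}" "B \<subseteq> {1..N}" "A' \<subseteq> {1..N'}" "B' \<subseteq> {1..N'}"
      by (auto simp: su_index_def)
    then have fin: "finite A" "finite B" "finite A'" "finite B'"
      by (auto intro: finite_subset)
    \<comment> \<open>The peak position of the common list tells where to cut it.\<close>
    have "card A = card A'"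
      using peak_pos_su_of[of A N B] peak_pos_su_of[of A' N' B'] sub eq by simp
    then have "length (sorted_list_of_set A) = length (sorted_list_of_set A')"
      by simp
    then have "sorted_list_of_set A = sorted_list_of_set A' \<and> N = N' \<and>
        sorted_list_of_set B = sorted_list_of_set B'"
      using eq by (simp add: su_of_def)
    with fin show "z = z'"
      by (simp add: z sorted_list_of_set_inject)
  qed
  show "su_of ` su_index = {xs. strongly_unimodal xs}"
  proof (intro equalityI subsetI)
    fix xs assume "xs \<in> su_of ` su_index"
    then show "xs \<in> {xs. strongly_unimodal xs}"
      using strongly_unimodal_su_of by (auto simp: su_index_def)
  next
    fix xs assume "xs \<in> {xs. strongly_unimodal xs}"
    then have "strongly_unimodal xs"
      by simp
    then obtain ys p zs where xs: "xs = ys @ p # zs" "sorted_wrt (<) (ys @ [p])"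
        "sorted_wrt (>) (p # zs)" "\<forall>x\<in>set xs. 0 < x"
      by (rule strongly_unimodalE)
    have lt: "\<forall>y\<in>set ys. y < p" "\<forall>z\<in>set zs. z < p"
      using xs(2,3) by (simp_all add: sorted_wrt_append)
    have pos: "\<forall>y\<in>set ys. 0 < y" "\<forall>z\<in>set zs. 0 < z" "p > 0"
      using xs(4) unfolding xs(1) by simp_all
    have "y \<in> {1..p - 1}" if "0 < y" "y < p" for y
      using that by auto
    with lt pos have sub: "set ys \<subseteq> {1..p - 1}" "set zs \<subseteq> {1..p - 1}"
      by blast+
    have sorted: "sorted_list_of_set (set l) = l" if "sorted_wrt (<) l" for l :: "nat list"
      using that strict_sorted_iff by (intro sorted_list_of_set.idem_if_sorted_distinct) blast+
    have "sorted_wrt (<) ys" "sorted_wrt (<) (rev zs)"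
      using xs(2,3) by (simp_all add: sorted_wrt_append sorted_wrt_rev)
    from this[THEN sorted] have "sorted_list_of_set (set ys) = ys" "sorted_list_of_set (set zs) = rev zs"
      by simp_all
    with sub pos(3) have "su_of (p - 1, set ys, set zs) = xs" "(p - 1, set ys, set zs) \<in> su_index"
      by (auto simp: su_of_def su_index_def xs(1))
    then show "xs \<in> su_of ` su_index"
      by blast
  qed
qed

section \<open>Summation over all strongly unimodal sequences\<close>

lemma sum_Pow_eq_prod:
  fixes q y :: real
  assumes "finite S"
  shows "(\<Sum>X\<in>Pow S. y ^ card X * q ^ \<Sum>X) = (\<Prod>j\<in>S. 1 + y * q ^ j)"
proof -
  have "(\<Prod>j\<in>S. 1 + y * q ^ j) = (\<Sum>X\<in>Pow S. \<Prod>j\<in>X. y * q ^ j)"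
    using prod_add[OF assms, of "\<lambda>j. y * q ^ j" "\<lambda>_. 1"] by (simp add: add.commute)
  also have "\<dots> = (\<Sum>X\<in>Pow S. y ^ card X * q ^ \<Sum>X)"
    by (simp add: prod.distrib power_sum)
  finally show ?thesis ..
qed

text \<open>For a fixed peak the sum over A and B splits into two products, exp (- x) marking
  entries before the peak and exp x those after it. All terms are nonnegative, so these finite sums
  combine over N into an unconditional sum.\<close>

lemma has_sum_exp_su_rank:
  fixes x q :: real
  assumes q: "q > 0" and summable: "summable (\<lambda>N. q ^ Suc N * su_prod x q N)"
  shows "((\<lambda>xs. exp (x * of_int (su_rank xs)) * q ^ sum_list xs) has_sum su_rank_gf x q)
           {xs. strongly_unimodal xs}"
proof -
  define F where "F z = exp (x * of_int (su_rank (su_of z))) * q ^ sum_list (su_of z)" for z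
  have inner: "((\<lambda>z. F (N, z)) has_sum q ^ Suc N * su_prod x q N) (Pow {1..N} \<times> Pow {1..N})" for N
  proof -
    have "F (N, A, B) = q ^ Suc N * (exp (- x) ^ card A * q ^ \<Sum>A) * (exp x ^ card B * q ^ \<Sum>B)"
      if "A \<subseteq> {1..N}" "B \<subseteq> {1..N}" for A B
    proof -
      have "exp (x * (real (card B) - real (card A))) = exp x ^ card B * exp (- x) ^ card A"
        by (simp add: algebra_simps flip: exp_of_nat_mult exp_add)
      then show ?thesis
        using that by (simp add: F_def su_rank_su_of sum_list_su_of power_add)
    qed
    then have "(\<Sum>z\<in>Pow {1..N} \<times> Pow {1..N}. F (N, z)) =
        (\<Sum>(A, B)\<in>Pow {1..N} \<times> Pow {1..N}.
           q ^ Suc N * ((exp (- x) ^ card A * q ^ \<Sum>A) * (exp x ^ card B * q ^ \<Sum>B)))"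
      by (intro sum.cong) (auto simp: mult.assoc)
    also have "\<dots> = q ^ Suc N * ((\<Sum>A\<in>Pow {1..N}. exp (- x) ^ card A * q ^ \<Sum>A) *
        (\<Sum>B\<in>Pow {1..N}. exp x ^ card B * q ^ \<Sum>B))"
      by (subst sum_product) (simp only: sum_distrib_left sum.cartesian_product case_prod_unfold)
    also have "\<dots> = q ^ Suc N * su_prod x q N"
      by (simp add: sum_Pow_eq_prod su_prod_def prod.distrib)
    finally show ?thesis
      by (intro has_sum_finiteI) auto
  qed
  have outer: "((\<lambda>N. q ^ Suc N * su_prod x q N) has_sum su_rank_gf x q) UNIV"
    unfolding su_rank_gf_def using summable_sums[OF summable] su_prod_pos[OF q] q
    by (intro sums_nonneg_imp_has_sum) (auto simp: less_imp_le)
  have "(F has_sum su_rank_gf x q) su_index"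
    unfolding su_index_def
    by (rule has_sum_SigmaI[OF inner outer summable_on_SigmaI[OF inner has_sum_imp_summable[OF outer]]])
       (use q in \<open>auto simp: F_def\<close>)
  then show ?thesis
    unfolding F_def using has_sum_reindex_bij_betw[OF bij_betw_su_of] by blast
qed

section \<open>Symmetrisation in x and the even rank moments\<close>

lemma su_rank_gf_minus: "su_rank_gf (- x) q = su_rank_gf x q"
  by (simp add: su_rank_gf_def su_prod_def mult.commute)

lemma cosh_even_has_sum:
  "((\<lambda>k. y ^ (2 * k) / fact (2 * k)) has_sum cosh y) UNIV" for y :: real
proof (rule sums_nonneg_imp_has_sum)
  have "(\<lambda>n. if even n then y ^ n /\<^sub>R fact n else 0) sums cosh y"
    by (rule cosh_converges)
  then have "(\<lambda>k. if even (2 * k) then y ^ (2 * k) /\<^sub>R fact (2 * k) else 0) sums cosh y"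
    by (subst sums_mono_reindex[where g = "\<lambda>k. 2 * k"])
       (auto simp: strict_mono_def elim!: evenE)
  then show "(\<lambda>k. y ^ (2 * k) / fact (2 * k)) sums cosh y"
    by (simp add: field_simps)
qed (simp add: power_mult)

text \<open>Averaging over x and - x replaces exp by cosh, whose power series has only nonnegative
  terms; this permits interchanging the sums below.\<close>

lemma su_rank_gf_has_sum_cosh:
  fixes x q :: real
  assumes q: "0 < q" "q < 1"
  shows "((\<lambda>xs. cosh (x * of_int (su_rank xs)) * q ^ sum_list xs) has_sum su_rank_gf x q)
           {xs. strongly_unimodal xs}"
proof -
  have t: "- ln q > 0" "q = exp (- (- ln q))"
    using q by auto
  have exp_sum: "((\<lambda>xs. exp (y * of_int (su_rank xs)) * q ^ sum_list xs) has_sum su_rank_gf y q)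
      {xs. strongly_unimodal xs}" for y
  proof -
    obtain L where "su_prod y q \<longlonglongrightarrow> L"
      using su_prod_limit[OF t(1), of y] t(2) by metis
    then show ?thesis
      using has_sum_exp_su_rank su_rank_gf_bounds(1) q by blast
  qed
  from has_sum_cmult_right[OF has_sum_add[OF exp_sum[of x] exp_sum[of "- x"]], of "1 / 2"]
  show ?thesis
    by (simp add: su_rank_gf_minus cosh_field_def field_simps)
qed

text \<open>Sequences are grouped by rank; ranks that do not occur contribute 0, which makes the sum
  over the integers finite.\<close>

lemma su_moment_eq_sum:
  "su_moment r n = (\<Sum>xs | strongly_unimodal xs \<and> sum_list xs = n. of_int (su_rank xs) ^ r)"
proof -
  let ?S = "{xs. strongly_unimodal xs \<and> sum_list xs = n}"
  have "su_moment r n = (\<Sum>\<^sub>\<infinity>m\<in>su_rank ` ?S. of_int m ^ r * of_nat (su_count m n))"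
    unfolding su_moment_def
  proof (rule infsum_cong_neutral)
    fix m assume "m \<in> UNIV - su_rank ` ?S"
    then have "{xs. strongly_unimodal xs \<and> sum_list xs = n \<and> su_rank xs = m} = {}"
      by auto
    then have "su_count m n = 0"
      by (simp only: su_count_def card.empty)
    then show "of_int m ^ r * of_nat (su_count m n) = (0::real)"
      by simp
  qed auto
  also have "\<dots> = (\<Sum>m\<in>su_rank ` ?S. of_int m ^ r * of_nat (su_count m n))"
    by (simp add: finite_strongly_unimodal)
  also have "\<dots> = (\<Sum>m\<in>su_rank ` ?S. \<Sum>xs\<in>{xs\<in>?S. su_rank xs = m}. of_int (su_rank xs) ^ r)"
    by (intro sum.cong) (simp_all add: su_count_def conj_assoc)
  also have "\<dots> = (\<Sum>xs\<in>?S. of_int (su_rank xs) ^ r)"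
    by (rule sum.group) (auto simp: finite_strongly_unimodal)
  finally show ?thesis .
qed

context
  fixes q :: real
  assumes q: "0 < q" "q < 1"
begin

text \<open>The index k is put first so that fixing it isolates a single moment.\<close>

lemma has_sum_cosh_expansion:
  "((\<lambda>(k, xs). (x * of_int (su_rank xs)) ^ (2 * k) / fact (2 * k) * q ^ sum_list xs)
      has_sum su_rank_gf x q) (UNIV \<times> {xs. strongly_unimodal xs})"
proof -
  define F where "F = (\<lambda>(xs, k). (x * of_int (su_rank xs)) ^ (2 * k) / fact (2 * k) * q ^ sum_list xs)"
  have inner: "((\<lambda>k. F (xs, k)) has_sum cosh (x * of_int (su_rank xs)) * q ^ sum_list xs) UNIV" for xs
    unfolding F_def prod.case by (intro has_sum_cmult_left cosh_even_has_sum)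
  note outer = su_rank_gf_has_sum_cosh[OF q]
  have "(F has_sum su_rank_gf x q) ({xs. strongly_unimodal xs} \<times> UNIV)"
    by (rule has_sum_SigmaI[OF inner outer summable_on_SigmaI[OF inner has_sum_imp_summable[OF outer]]])
       (use q in \<open>auto simp: F_def power_mult\<close>)
  then show ?thesis
    by (subst (asm) has_sum_swap) (simp add: F_def)
qed

text \<open>A slice at fixed k of the summable double family at x = 1, rescaled.\<close>

lemma su_moment_summable_on:
  "(\<lambda>xs. of_int (su_rank xs) ^ (2 * k) * q ^ sum_list xs) summable_on {xs. strongly_unimodal xs}"
proof -
  have "(\<lambda>xs. (1 * of_int (su_rank xs)) ^ (2 * k) / fact (2 * k) * q ^ sum_list xs) summable_on
      {xs. strongly_unimodal xs}"
    using summable_on_SigmaD1[OF has_sum_imp_summable[OF has_sum_cosh_expansion[of 1]], of k] by simp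
  then have "(\<lambda>xs. fact (2 * k) * ((1 * of_int (su_rank xs)) ^ (2 * k) / fact (2 * k) * q ^ sum_list xs))
      summable_on {xs. strongly_unimodal xs}"
    by (rule summable_on_cmult_right)
  then show ?thesis
    by simp
qed

text \<open>Grouping by size also shows that the series behind \<open>su_moment_gf\<close>
  converges, so that its value is a genuine sum.\<close>

lemma su_moment_gf_has_sum:
  "((\<lambda>xs. of_int (su_rank xs) ^ (2 * k) * q ^ sum_list xs) has_sum su_moment_gf (2 * k) q)
           {xs. strongly_unimodal xs}"
proof -
  define F :: "nat list \<Rightarrow> real" where "F xs = of_int (su_rank xs) ^ (2 * k) * q ^ sum_list xs" for xs
  define S where "S n = {xs. strongly_unimodal xs \<and> sum_list xs = n}" for n
  have bij: "bij_betw snd (SIGMA n:UNIV. S n) {xs. strongly_unimodal xs}"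
    by (rule bij_betwI[where g = "\<lambda>xs. (sum_list xs, xs)"]) (auto simp: S_def)
  have F: "(F has_sum infsum F {xs. strongly_unimodal xs}) {xs. strongly_unimodal xs}"
    unfolding F_def using su_moment_summable_on by (rule has_sum_infsum)
  then have "((\<lambda>z. F (snd z)) has_sum infsum F {xs. strongly_unimodal xs}) (SIGMA n:UNIV. S n)"
    using has_sum_reindex_bij_betw[OF bij] by blast
  moreover have "((\<lambda>xs. F (snd (n, xs))) has_sum su_moment (2 * k) n * q ^ n) (S n)" for n
    using finite_strongly_unimodal[of n]
    by (intro has_sum_finiteI) (auto simp: S_def F_def su_moment_eq_sum sum_distrib_right intro!: sum.cong)
  ultimately have "((\<lambda>n. su_moment (2 * k) n * q ^ n) has_sum infsum F {xs. strongly_unimodal xs}) UNIV"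
    by (rule has_sum_SigmaD)
  then have "su_moment_gf (2 * k) q = infsum F {xs. strongly_unimodal xs}"
    unfolding su_moment_gf_def using has_sum_imp_sums sums_unique by metis
  with F show ?thesis
    by (simp add: F_def [abs_def])
qed

lemma su_moment_gf_nonneg: "su_moment_gf (2 * k) q \<ge> 0"
  by (rule has_sum_nonneg[OF su_moment_gf_has_sum]) (use q in \<open>simp add: power_mult\<close>)

lemma su_moment_gf_sums:
  "(\<lambda>k. x ^ (2 * k) / fact (2 * k) * su_moment_gf (2 * k) q) sums su_rank_gf x q"
proof -
  have "((\<lambda>xs. (x * of_int (su_rank xs)) ^ (2 * k) / fact (2 * k) * q ^ sum_list xs) has_sum
      x ^ (2 * k) / fact (2 * k) * su_moment_gf (2 * k) q) {xs. strongly_unimodal xs}" for k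
    using has_sum_cmult_right[OF su_moment_gf_has_sum, of "x ^ (2 * k) / fact (2 * k)" k]
    by (simp add: power_mult_distrib mult.assoc)
  then have "((\<lambda>k. x ^ (2 * k) / fact (2 * k) * su_moment_gf (2 * k) q) has_sum su_rank_gf x q) UNIV"
    by (intro has_sum_SigmaD[OF has_sum_cosh_expansion]) auto
  then show ?thesis
    by (rule has_sum_imp_sums)
qed

end

section \<open>Convergence of coefficients\<close>

text \<open>Convergence at z = 1 puts 0 inside the disc of convergence, where the series is
  continuous.\<close>

lemma power_series_tendsto_0:
  fixes a :: "nat \<Rightarrow> real"
  assumes "\<And>z. z > 0 \<Longrightarrow> (\<lambda>k. a k * z ^ k) sums H z"
  shows "(H \<longlongrightarrow> a 0) (at_right 0)"
proof -
  have "isCont (\<lambda>z. \<Sum>k. a k * z ^ k) 0"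
    using assms[of 1] by (intro isCont_powser[where K = 1]) (auto simp: sums_iff)
  then have "((\<lambda>z. \<Sum>k. a k * z ^ k) \<longlongrightarrow> a 0) (at_right 0)"
    by (simp add: isCont_def powser_zero filterlim_at_split)
  then show ?thesis
    by (rule Lim_transform_eventually)
       (use eventually_at_right_less[of 0] assms in \<open>auto simp: sums_iff elim!: eventually_mono\<close>)
qed

text \<open>As z ^ k \<le> z for k \<ge> 1 and 0 < z < 1, nonnegativity gives G z - z * G 1 \<le> c
  0 \<le> G z. In the limit the outer terms become H z - z * H 1 and H z, which both tend to a 0 as
  z tends to 0.\<close>

lemma constant_coeff_tendsto:
  fixes c :: "nat \<Rightarrow> 'a \<Rightarrow> real"
  assumes nonneg: "\<forall>\<^sub>F t in F. \<forall>k. c k t \<ge> 0"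
    and G: "\<And>z. z > 0 \<Longrightarrow> \<forall>\<^sub>F t in F. (\<lambda>k. c k t * z ^ k) sums G z t"
    and lim: "\<And>z. z > 0 \<Longrightarrow> (G z \<longlongrightarrow> H z) F"
    and H: "\<And>z. z > 0 \<Longrightarrow> (\<lambda>k. a k * z ^ k) sums H z"
  shows "(c 0 \<longlongrightarrow> a 0) F"
proof -
  have H0: "(H \<longlongrightarrow> a 0) (at_right 0)"
    by (rule power_series_tendsto_0[OF H])
  have "((\<lambda>z. H z - z * H 1) \<longlongrightarrow> a 0 - 0 * H 1) (at_right 0)"
    by (intro tendsto_intros H0)
  then have H1: "((\<lambda>z. H z - z * H 1) \<longlongrightarrow> a 0) (at_right 0)"
    by simp
  have "\<forall>\<^sub>F z in at_right 0. z < (1::real)"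
    by (rule eventually_at_right_real[THEN eventually_mono]) auto
  then have z01: "\<forall>\<^sub>F z in at_right 0. 0 < z \<and> z < (1::real)"
    using eventually_at_right_less[of 0] by eventually_elim simp
  have upper: "\<forall>\<^sub>F t in F. c 0 t \<le> G z t" if "z > 0" for z
    using nonneg G[OF that]
  proof eventually_elim
    case (elim t)
    then have "(\<Sum>k\<in>{0}. c k t * z ^ k) \<le> (\<Sum>k. c k t * z ^ k)"
      using that by (intro sum_le_suminf) (auto simp: sums_iff)
    with elim show ?case by (simp add: sums_iff)
  qed
  have lower: "\<forall>\<^sub>F t in F. G z t - z * G 1 t \<le> c 0 t" if z: "0 < z" "z < 1" for z
    using nonneg G[OF z(1)] G[OF zero_less_one]
  proof eventually_elim
    case (elim t)
    have "G z t \<le> c 0 t + z * G 1 t"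
    proof (rule sums_le)
      show "(\<lambda>k. c k t * z ^ k) sums G z t"
        by (rule elim)
      show "(\<lambda>k. (if k = 0 then c 0 t else 0) + z * (c k t * 1 ^ k)) sums (c 0 t + z * G 1 t)"
        using elim by (intro sums_add sums_mult sums_single[of 0 "\<lambda>_. c 0 t"]) auto
      show "c k t * z ^ k \<le> (if k = 0 then c 0 t else 0) + z * (c k t * 1 ^ k)" for k
      proof (cases k)
        case (Suc n)
        have "z ^ n \<le> 1"
          using z by (intro power_le_one) auto
        then have "c k t * z * z ^ n \<le> c k t * z * 1"
          using elim z by (intro mult_left_mono) auto
        then show ?thesis
          using Suc by (simp add: mult_ac)
      qed (use elim z in auto)
    qed
    then show ?case by simp
  qed
  \<comment> \<open>Given e, first fix z so small that the limiting bound beats e; only then let t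
    run along \<open>F\<close>.\<close>
  show ?thesis
  proof (rule order_tendstoI)
    fix e assume "e < a 0"
    with z01 order_tendstoD(1)[OF H1] have "\<forall>\<^sub>F z in at_right 0. 0 < z \<and> z < 1 \<and> e < H z - z * H 1"
      by (auto intro: eventually_elim2)
    then obtain z where z: "0 < z" "z < 1" "e < H z - z * H 1"
      using eventually_happens trivial_limit_at_right_real by blast
    have "((\<lambda>t. G z t - z * G 1 t) \<longlongrightarrow> H z - z * H 1) F"
      using z by (intro tendsto_intros lim) auto
    from order_tendstoD(1)[OF this z(3)] lower[OF z(1,2)] show "\<forall>\<^sub>F t in F. e < c 0 t"
      by eventually_elim simp
  next
    fix e assume "a 0 < e"
    with z01 order_tendstoD(2)[OF H0] have "\<forall>\<^sub>F z in at_right 0. 0 < z \<and> H z < e"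
      by (auto intro: eventually_elim2)
    then obtain z where z: "0 < z" "H z < e"
      using eventually_happens trivial_limit_at_right_real by blast
    from order_tendstoD(2)[OF lim[OF z(1)] z(2)] upper[OF z(1)] show "\<forall>\<^sub>F t in F. c 0 t < e"
      by eventually_elim simp
  qed
qed

text \<open>Induction on k: removing the constant coefficients and dividing by z gives shifted
  series that satisfy the same hypotheses.\<close>

lemma coeff_tendsto:
  fixes c :: "nat \<Rightarrow> 'a \<Rightarrow> real"
  assumes nonneg: "\<forall>\<^sub>F t in F. \<forall>k. c k t \<ge> 0"
    and G: "\<And>z. z > 0 \<Longrightarrow> \<forall>\<^sub>F t in F. (\<lambda>k. c k t * z ^ k) sums G z t"
    and lim: "\<And>z. z > 0 \<Longrightarrow> (G z \<longlongrightarrow> H z) F"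
    and H: "\<And>z. z > 0 \<Longrightarrow> (\<lambda>k. a k * z ^ k) sums H z"
  shows "(c k \<longlongrightarrow> a k) F"
  using assms
proof (induction k arbitrary: c G H a)
  case 0
  then show ?case by (rule constant_coeff_tendsto)
next
  case (Suc k)
  have shift: "(\<lambda>k. b (Suc k) * z ^ k) sums ((S - b 0) / z)"
    if "(\<lambda>k. b k * z ^ k) sums S" "z > 0" for b :: "nat \<Rightarrow> real" and z S
  proof -
    have "(\<lambda>k. b (Suc k) * z ^ Suc k) sums (S - b 0)"
      using that(1) sums_Suc_iff[of "\<lambda>k. b k * z ^ k" "S - b 0"] by simp
    from sums_divide[OF this, of z] that(2) show ?thesis
      by (simp add: mult_ac)
  qed
  show ?case
  proof (rule Suc.IH[where c = "\<lambda>k. c (Suc k)" and a = "\<lambda>k. a (Suc k)"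
        and G = "\<lambda>z t. (G z t - c 0 t) / z" and H = "\<lambda>z. (H z - a 0) / z"])
    show "\<forall>\<^sub>F t in F. \<forall>k. 0 \<le> c (Suc k) t"
      using Suc.prems(1) by (rule eventually_mono) auto
  next
    fix z :: real assume z: "z > 0"
    show "\<forall>\<^sub>F t in F. (\<lambda>k. c (Suc k) t * z ^ k) sums ((G z t - c 0 t) / z)"
      using Suc.prems(2)[OF z] by (rule eventually_mono) (rule shift[OF _ z])
    show "((\<lambda>t. (G z t - c 0 t) / z) \<longlongrightarrow> (H z - a 0) / z) F"
      using z by (intro tendsto_intros Suc.prems(3) constant_coeff_tendsto[OF Suc.prems]) auto
    show "(\<lambda>k. a (Suc k) * z ^ k) sums ((H z - a 0) / z)"
      using Suc.prems(4)[OF z] z by (rule shift)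
  qed
qed

text \<open>Turns (2 * k)! times the Gaussian coefficient 1 / (2 ^ k * k!) into the double
  factorial.\<close>

lemma odd_dfact_times: "odd_dfact k * (2 ^ k * fact k) = fact (2 * k)"
proof (induction k)
  case (Suc k)
  have "odd_dfact (Suc k) = odd_dfact k * (2 * k + 1)"
    by (simp add: odd_dfact_def)
  then have "odd_dfact (Suc k) * (2 ^ Suc k * fact (Suc k)) =
      odd_dfact k * (2 ^ k * fact k) * ((2 * k + 1) * (2 * Suc k))"
    by (simp add: algebra_simps)
  also have "\<dots> = fact (2 * Suc k)"
    unfolding Suc.IH by (simp add: algebra_simps)
  finally show ?case .
qed (simp add: odd_dfact_def)

text \<open>With s = sqrt z, the quotient in \<open>su_rank_gf_asymp\<close> is a power series in z
  with nonnegative coefficients and limit exp (z / 2), so \<open>coeff_tendsto\<close>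
  applies.\<close>

lemma su_moment_gf_scaled_tendsto:
  "((\<lambda>t. su_moment_gf (2 * k) (exp (- t)) * t ^ k / fact (2 * k) / (exp (pi\<^sup>2 / (6 * t)) / 4))
      \<longlongrightarrow> (1 / 2) ^ k / fact k) (at_right 0)"
proof -
  define c where "c k t = su_moment_gf (2 * k) (exp (- t)) * t ^ k / fact (2 * k) / (exp (pi\<^sup>2 / (6 * t)) / 4)"
    for k t
  define G where "G z t = su_rank_gf (sqrt z * sqrt t) (exp (- t)) / (exp (pi\<^sup>2 / (6 * t)) / 4)" for z t
  have pos: "\<forall>\<^sub>F t in at_right (0::real). 0 < t"
    by (rule eventually_at_right_less)
  have "(c k \<longlongrightarrow> (1 / 2) ^ k / fact k) (at_right 0)"
  proof (rule coeff_tendsto[where c = c and G = G])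
    show "\<forall>\<^sub>F t in at_right 0. \<forall>k. 0 \<le> c k t"
      using pos by eventually_elim (auto simp: c_def su_moment_gf_nonneg)
  next
    fix z :: real assume z: "z > 0"
    show "\<forall>\<^sub>F t in at_right 0. (\<lambda>k. c k t * z ^ k) sums G z t"
      using pos
    proof eventually_elim
      case (elim t)
      have "(sqrt z * sqrt t) ^ (2 * k) = z ^ k * t ^ k" for k
        using z elim by (simp add: power_mult power_mult_distrib)
      then show ?case
        using sums_divide[OF su_moment_gf_sums[of "exp (- t)" "sqrt z * sqrt t"], of "exp (pi\<^sup>2 / (6 * t)) / 4"]
          elim by (simp add: c_def G_def mult_ac)
    qed
    show "(G z \<longlongrightarrow> exp (z / 2)) (at_right 0)"
      using su_rank_gf_asymp[of "sqrt z"] z by (simp add: G_def [abs_def])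
    show "(\<lambda>k. (1 / 2) ^ k / fact k * z ^ k) sums exp (z / 2)"
      using exp_converges[of "z / 2"] by (simp add: power_divide field_simps)
  qed
  then show ?thesis
    by (simp add: c_def [abs_def])
qed

theorem theorem4p3:
  fixes k :: nat
  shows "(\<lambda>t::real. su_moment_gf (2 * k) (exp (- t)))
           \<sim>[at_right 0]
         (\<lambda>t. real (odd_dfact k) / 4 * t powi (- int k) * exp (pi\<^sup>2 / (6 * t)))"
proof (rule asymp_equivI')
  let ?L = "\<lambda>t. su_moment_gf (2 * k) (exp (- t)) * t ^ k / fact (2 * k) / (exp (pi\<^sup>2 / (6 * t)) / 4)"
  have fact_eq: "real (odd_dfact k) * (2 ^ k * fact k) = fact (2 * k)"
    using arg_cong[OF odd_dfact_times[of k], of real] by simp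
  then have nz: "real (odd_dfact k) \<noteq> 0"
    by (metis fact_nonzero mult_zero_left)
  \<comment> \<open>The prefactor equals 2 ^ k * k! and so normalises the limit to 1.\<close>
  have "((\<lambda>t. fact (2 * k) / real (odd_dfact k) * ?L t) \<longlongrightarrow>
      fact (2 * k) / real (odd_dfact k) * ((1 / 2) ^ k / fact k)) (at_right 0)"
    by (intro tendsto_mult su_moment_gf_scaled_tendsto tendsto_const)
  also have "fact (2 * k) / real (odd_dfact k) * ((1 / 2) ^ k / fact k) = 1"
    using nz by (simp add: power_divide flip: fact_eq)
  finally show "((\<lambda>t. su_moment_gf (2 * k) (exp (- t)) /
      (real (odd_dfact k) / 4 * t powi (- int k) * exp (pi\<^sup>2 / (6 * t)))) \<longlongrightarrow> 1) (at_right 0)"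
  proof (rule Lim_transform_eventually)
    show "\<forall>\<^sub>F t in at_right 0. fact (2 * k) / real (odd_dfact k) * ?L t =
        su_moment_gf (2 * k) (exp (- t)) / (real (odd_dfact k) / 4 * t powi (- int k) * exp (pi\<^sup>2 / (6 * t)))"
      using eventually_at_right_less[of 0]
    proof eventually_elim
      case (elim t)
      then have "t powi (- int k) = 1 / t ^ k"
        by (simp add: power_int_minus field_simps)
      with elim nz show ?case
        by (simp add: field_simps)
    qed
  qed
qed

end
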